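(* Let $d\mu$ be any probability measure on $\partial\mathbb{D}$ with $\operatorname{supp}(d\mu)=\partial\mathbb{D}$. Then there exists a probability measure $d\nu$ on $\partial\mathbb{D}$ equivalent to $d\mu$ (i.e., mutually absolutely continuous with $d\mu$) so that for all $p>2$, $$\sum_{n=0}^\infty |\alpha_n(d\nu)|^p<\infty .$$
   Context: $\mathbb{D}=\{|z|<1\}$. For a probability measure $\nu$ on $\partial\mathbb{D}$ that is not a finite combination of delta functions, $\Phi_n(z;d\nu)$ is the monic orthogonal polynomial of degree $n$ in $L^2(\partial\mathbb{D},d\nu)$ and the Verblunsky coefficients are $\alpha_n(d\nu)=-\overline{\Phi_{n+1}(0;d\nu)}\in\mathbb{D}$, $n\ge0$. *)

theory Defs
  imports "HOL-Probability.Probability" "HOL-Computational_Algebra.Polynomial"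
begin

definition circle_prob_measure :: "complex measure \<Rightarrow> bool" where
  "circle_prob_measure M \<longleftrightarrow> prob_space M \<and> sets M = sets (restrict_space borel (sphere 0 1))"

definition supp_measure :: "'a::topological_space measure \<Rightarrow> 'a set" where
  "supp_measure M = {x \<in> space M. \<forall>U. open U \<longrightarrow> x \<in> U \<longrightarrow> emeasure M (U \<inter> space M) > 0}"

definition equivalent_measures :: "'a measure \<Rightarrow> 'a measure \<Rightarrow> bool" where
  "equivalent_measures M N \<longleftrightarrow> absolutely_continuous M N \<and> absolutely_continuous N M"

definition is_monic_orthogonal :: "complex measure \<Rightarrow> nat \<Rightarrow> complex poly \<Rightarrow> bool" where
  "is_monic_orthogonal M n p \<longleftrightarrow> degree p = n \<and> lead_coeff p = 1 \<and>
     (\<forall>q. degree q < n \<longrightarrow> (LINT z|M. cnj (poly q z) * poly p z) = 0)"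

(* Only meaningful when M is not a finite combination of delta functions; existence and
   uniqueness of the polynomial in that case are proved in ex1_monic_orthogonal. *)
definition opuc :: "complex measure \<Rightarrow> nat \<Rightarrow> complex poly" where
  "opuc M n = (THE p. is_monic_orthogonal M n p)"

definition verblunsky :: "complex measure \<Rightarrow> nat \<Rightarrow> complex" where
  "verblunsky M n = - cnj (poly (opuc M (Suc n)) 0)"

lemma circle_prob_measureD:
  assumes "circle_prob_measure M"
  shows "prob_space M" "space M = sphere 0 1" "sets M = sets (restrict_space borel (sphere 0 1))"
proof -
  show *: "prob_space M" "sets M = sets (restrict_space borel (sphere 0 1))"
    using assms by (auto simp: circle_prob_measure_def)
  show "space M = sphere 0 1"
    using sets_eq_imp_space_eq[OF *(2)] by (simp add: space_restrict_space)
qed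

lemma integrable_circle:
  fixes f :: "complex \<Rightarrow> complex"
  assumes M: "circle_prob_measure M" and f: "continuous_on UNIV f"
  shows "integrable M f"
proof -
  interpret prob_space M by (rule circle_prob_measureD[OF M])
  have "f \<in> borel_measurable (restrict_space borel (sphere 0 1))"
    by (intro measurable_restrict_space1 borel_measurable_continuous_onI f)
  then have meas: "f \<in> borel_measurable M"
    using measurable_cong_sets[OF circle_prob_measureD(3)[OF M] refl] by blast
  have "compact (f ` sphere 0 1)"
    by (intro compact_continuous_image continuous_on_subset[OF f]) auto
  then obtain B where "\<forall>x\<in>f ` sphere 0 1. norm x \<le> B"
    using compact_imp_bounded bounded_iff by metis
  then show ?thesis
    by (intro integrable_const_bound[of _ B] meas AE_I2)
       (auto simp: circle_prob_measureD(2)[OF M])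
qed

lemma full_support_not_finitely_supported:
  assumes M: "circle_prob_measure M" and supp: "supp_measure M = sphere 0 1"
    and A: "finite A" "A \<subseteq> sphere 0 1"
  shows "emeasure M A \<noteq> 1"
proof
  interpret prob_space M by (rule circle_prob_measureD[OF M])
  assume 1: "emeasure M A = 1"
  have "infinite (sphere 0 1 :: complex set)"
  proof
    assume "finite (sphere 0 1 :: complex set)"
    moreover have "cis ` {0..1} \<subseteq> sphere 0 1" by auto
    ultimately have "finite (cis ` {0..1})" by (rule rev_finite_subset)
    moreover have "inj_on cis {0..1}"
    proof (rule inj_onI)
      fix x y :: real assume *: "x \<in> {0..1}" "y \<in> {0..1}" "cis x = cis y"
      then have "cos x = cos y" by (metis cis.sel(1))
      with * show "x = y" using pi_gt3 cos_inj_pi[of x y] by auto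
    qed
    ultimately have "finite {0..1::real}" by (rule finite_imageD)
    then show False by (simp add: infinite_Icc)
  qed
  then obtain z where z: "z \<in> sphere 0 1" "z \<notin> A"
    using A by (metis finite_subset subsetI)
  have A_meas: "A \<in> sets M"
    using A finite_imp_closed[OF A(1)]
    by (auto simp: circle_prob_measureD(3)[OF M] sets_restrict_space_iff)
  have "emeasure M (space M - A) = 0"
    using 1 A_meas prob_compl[OF A_meas] by (simp add: emeasure_eq_measure)
  moreover have "open (- A)" "z \<in> - A" using z A by (auto simp: finite_imp_closed)
  ultimately have "z \<notin> supp_measure M"
    unfolding supp_measure_def
    by (auto simp: Diff_eq Int_commute intro!: exI[of _ "- A"])
  with z supp show False by simp
qed

lemma supp_measure_equivalent:
  assumes "sets M = sets N" "equivalent_measures M N"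
    and "\<And>U. open U \<Longrightarrow> U \<inter> space M \<in> sets M"
  shows "supp_measure M = supp_measure N"
proof -
  have sp: "space M = space N" by (rule sets_eq_imp_space_eq[OF assms(1)])
  have "emeasure M A = 0 \<longleftrightarrow> emeasure N A = 0" if "A \<in> sets M" for A
    using assms(1,2) that
    by (auto simp: equivalent_measures_def absolutely_continuous_def null_sets_def)
  then show ?thesis
    using assms(3) unfolding supp_measure_def sp zero_less_iff_neq_zero by blast
qed

lemma ex1_monic_orthogonal:
  assumes M: "circle_prob_measure M"
    and nontrivial: "\<And>A. finite A \<Longrightarrow> A \<subseteq> sphere 0 1 \<Longrightarrow> emeasure M A \<noteq> 1"
  shows "\<exists>!p. is_monic_orthogonal M n p"
proof -
  interpret prob_space M by (rule circle_prob_measureD[OF M])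
  define ip where "ip q p = (LINT z|M. cnj (poly q z) * poly p z)" for p q
  have int: "integrable M (\<lambda>z. cnj (poly q z) * poly p z)" for p q
    by (intro integrable_circle[OF M] continuous_intros)
  have ip_add: "ip q (p + r) = ip q p + ip q r" "ip (q + r) p = ip q p + ip r p"
    and ip_diff: "ip q (p - r) = ip q p - ip q r" "ip (q - r) p = ip q p - ip r p"
    and ip_smult: "ip q (smult c p) = c * ip q p" "ip (smult c q) p = cnj c * ip q p" for p q r c
    using int[of q p] int[of q r] int[of r p]
    by (simp_all add: ip_def distrib_left distrib_right left_diff_distrib right_diff_distrib
          mult.assoc mult.left_commute[of _ c])
  have ip0: "ip 0 p = 0" "ip q 0 = 0" for p q by (simp_all add: ip_def)
  have ip_sum: "ip q (\<Sum>k\<in>A. f k) = (\<Sum>k\<in>A. ip q (f k))" for q A and f :: "nat \<Rightarrow> complex poly"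
    by (induction A rule: infinite_finite_induct) (auto simp: ip_add ip0)
  have ip_pos: "p = 0" if "ip p p = 0" for p
  proof (rule ccontr)
    assume "p \<noteq> 0"
    then have fin: "finite {z. poly p z = 0}" by (rule poly_roots_finite)
    have eq: "cnj (poly p z) * poly p z = of_real ((cmod (poly p z))\<^sup>2)" for z
      by (metis complex_norm_square mult.commute)
    have int': "integrable M (\<lambda>z. (cmod (poly p z))\<^sup>2)"
      using int[of p p] unfolding eq complex_of_real_integrable_eq .
    have "(LINT z|M. (cmod (poly p z))\<^sup>2) = 0"
      using that unfolding ip_def eq integral_complex_of_real of_real_eq_0_iff .
    then have "AE z in M. (cmod (poly p z))\<^sup>2 = 0"
      using integral_nonneg_eq_0_iff_AE[OF int'] by simp
    then have "AE z in M. z \<in> {z. poly p z = 0} \<inter> sphere 0 1"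
      using AE_space by eventually_elim (auto simp: circle_prob_measureD(2)[OF M])
    moreover have "{z. poly p z = 0} \<inter> sphere 0 1 \<in> sets M"
      using finite_imp_closed[OF fin]
      by (auto simp: circle_prob_measureD(3)[OF M] sets_restrict_space)
    ultimately have "emeasure M ({z. poly p z = 0} \<inter> sphere 0 1) = 1"
      by (simp add: emeasure_eq_1_AE)
    with nontrivial[of "{z. poly p z = 0} \<inter> sphere 0 1"] fin show False by simp
  qed
  have mop: "is_monic_orthogonal M n p \<longleftrightarrow> degree p = n \<and> lead_coeff p = 1 \<and>
    (\<forall>q. degree q < n \<longrightarrow> ip q p = 0)" for n p
    by (simp add: is_monic_orthogonal_def ip_def)
  have ex: "\<exists>p. is_monic_orthogonal M n p" for n
  proof (induction n rule: less_induct)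
    case (less n)
    then have "\<forall>m. \<exists>p. m < n \<longrightarrow> is_monic_orthogonal M m p" by blast
    from choice[OF this] obtain P where P: "\<And>m. m < n \<Longrightarrow> is_monic_orthogonal M m (P m)"
      by blast
    have degP: "degree (P m) = m" "coeff (P m) m = 1" if "m < n" for m
      using P[OF that] by (auto simp: mop)
    have norm: "ip (P m) (P m) \<noteq> 0" if "m < n" for m
    proof
      assume "ip (P m) (P m) = 0"
      then have "P m = 0" by (rule ip_pos)
      with degP(2)[OF that] show False by simp
    qed
    have cnj_ip: "ip q p = cnj (ip p q)" for p q
      unfolding ip_def Bochner_Integration.integral_cnj[symmetric]
      by (rule Bochner_Integration.integral_cong) (simp_all add: mult.commute)
    have orth: "ip (P j) (P k) = 0" if "j < n" "k < n" "j \<noteq> k" for j k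
    proof (cases "j < k")
      case True
      then show ?thesis using P[of k] that degP by (simp add: mop)
    next
      case False
      then have "ip (P k) (P j) = 0" using P[of j] that degP by (simp add: mop)
      then show ?thesis using cnj_ip[of "P j" "P k"] by simp
    qed
    define S where "S = (\<Sum>k<n. smult (ip (P k) (monom 1 n) / ip (P k) (P k)) (P k))"
    have S_coeff: "coeff S i = 0" if "i \<ge> n" for i
      unfolding S_def coeff_sum
    proof (rule sum.neutral, rule ballI)
      fix k assume "k \<in> {..<n}"
      then have "coeff (P k) i = 0" using degP that by (intro coeff_eq_0) auto
      then show "coeff (smult (ip (P k) (monom 1 n) / ip (P k) (P k)) (P k)) i = 0" by simp
    qed
    define p where "p = monom 1 n - S"
    have p_coeff: "coeff p n = 1" "\<And>i. i > n \<Longrightarrow> coeff p i = 0"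
      using S_coeff by (auto simp: p_def)
    have deg: "degree p = n"
    proof (rule antisym)
      show "degree p \<le> n" using p_coeff(2) by (intro degree_le) auto
      show "n \<le> degree p" using p_coeff(1) by (intro le_degree) auto
    qed
    have ortho: "ip (P j) p = 0" if j: "j < n" for j
    proof -
      have "ip (P j) S = (\<Sum>k<n. if k = j then ip (P j) (monom 1 n) else 0)"
        unfolding S_def ip_sum ip_smult using j orth norm by (intro sum.cong) auto
      also have "\<dots> = ip (P j) (monom 1 n)" using j by simp
      finally show ?thesis by (simp add: p_def ip_diff)
    qed
    have span: "ip q p = 0" if "k \<le> n" "\<And>i. i \<ge> k \<Longrightarrow> coeff q i = 0" for q k
      using that
    proof (induction k arbitrary: q)
      case 0
      then have "q = 0" by (simp add: poly_eq_iff)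
      then show ?case by (simp add: ip0)
    next
      case (Suc k)
      have coeff0: "coeff (q - smult (coeff q k) (P k)) i = 0" if "i \<ge> k" for i
      proof (cases "i = k")
        case True
        then show ?thesis using degP[of k] Suc.prems by simp
      next
        case False
        then have "coeff (P k) i = 0" using degP[of k] that Suc.prems by (intro coeff_eq_0) auto
        then show ?thesis using False that Suc.prems by simp
      qed
      have "ip (q - smult (coeff q k) (P k)) p = 0"
        by (rule Suc.IH[OF Suc_leD[OF Suc.prems(1)] coeff0])
      moreover have "ip (P k) p = 0" using Suc.prems(1) by (intro ortho) simp
      ultimately show ?case by (simp only: ip_diff ip_smult mult_zero_right diff_zero)
    qed
    have "ip q p = 0" if "degree q < n" for q
      by (rule span[OF order_refl]) (use that in \<open>simp add: coeff_eq_0\<close>)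
    then have "is_monic_orthogonal M n p"
      unfolding mop deg p_coeff(1) by blast
    then show ?case by (rule exI)
  qed
  have "p = q" if p: "is_monic_orthogonal M n p" and q: "is_monic_orthogonal M n q" for p q
  proof (cases "n = 0")
    case True
    then obtain a b where "p = [:a:]" "q = [:b:]"
      using p q degree_eq_zeroE unfolding mop by metis
    then show ?thesis using p q unfolding mop by simp
  next
    case False
    have *: "degree (p - q) < n"
    proof (intro degree_lessI allI impI)
      show "p - q \<noteq> 0 \<or> 0 < n" using False by simp
      fix k assume "n \<le> k"
      then show "coeff (p - q) k = 0"
        using p q by (cases "k = n") (auto simp: mop coeff_eq_0)
    qed
    have "ip (p - q) (p - q) = 0"
      using p q * unfolding mop ip_diff(1) by simp
    from ip_pos[OF this] show ?thesis by simp
  qed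
  then show ?thesis by (rule ex_ex1I[OF ex])
qed

end

theory Submission
  imports Defs "HOL-Real_Asymp.Real_Asymp"
begin

text \<open>
  Write \<open>\<Lambda> n(\<nu>)\<close> for the minimum of \<open>\<integral>\<bar>P\<bar>\<^sup>2 d\<nu>\<close> over monic \<open>P\<close> of degree \<open>n\<close>. Then
  \<open>\<bar>\<alpha> n\<bar>\<^sup>2 \<Lambda> n \<le> \<Lambda> n - \<Lambda> (n + 1)\<close>, so the squares of the Verblunsky coefficients over a block
  \<open>N k \<le> n < N (k + 1)\<close> sum to at most \<open>\<Lambda> (N k) / \<Lambda> (N (k + 1)) - 1\<close>. It suffices to make this \<open>O(1 / k)\<close>, since
  the \<open>p\<close>-th powers over the block then sum to \<open>O(k powr (- p / 2))\<close>.

  The measure \<open>\<nu>\<close> is the limit of measures \<open>\<nu> k\<close>, each the sum of a weight times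
  \<open>\<mu>\<close> and \<open>1 / (k + 2)\<close> times Lebesgue measure. In passing from \<open>\<nu> k\<close> to \<open>\<nu> (k + 1)\<close> a part of the Lebesgue
  summand is replaced by a weight with respect to \<open>\<mu>\<close> that is close to Lebesgue measure on polynomials of degree at most
  \<open>N k\<close>; such weights exist because the support is full. As \<open>\<nu> (k + 1) \<ge> (k + 2) / (k + 3) \<nu> k\<close>, no minimum
  drops by more than this factor, whereas \<open>N k\<close> is chosen so large that \<open>\<Lambda> (N k)\<close> has almost reached its limit for \<open>\<nu> k\<close>.
\<close>

section \<open>Lebesgue measure as a form on polynomials, and its discretization\<close>

text \<open>By Parseval this is the integral of the squared modulus of \<open>P\<close> against
  normalized Lebesgue measure on the circle. In this form Lebesgue measure enters the construction
  through coefficients alone.\<close>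

definition coeff_sqnorm :: "complex poly \<Rightarrow> real" where
  "coeff_sqnorm P = (\<Sum>i\<le>degree P. (cmod (coeff P i))\<^sup>2)"

lemma coeff_sqnorm_nonneg: "0 \<le> coeff_sqnorm P"
  by (simp add: coeff_sqnorm_def sum_nonneg)

lemma coeff_sqnorm_monic_ge_1:
  assumes "lead_coeff P = 1"
  shows "1 \<le> coeff_sqnorm P"
proof -
  have "(cmod (lead_coeff P))\<^sup>2 \<le> coeff_sqnorm P"
    unfolding coeff_sqnorm_def by (rule member_le_sum) auto
  with assms show ?thesis by simp
qed

text \<open>Each summand is the \<open>j\<close>-th power of one \<open>M\<close>-th root of unity
  \<open>\<omega>\<close>. As \<open>i\<close> and \<open>l\<close> lie below \<open>M\<close>,
  \<open>\<omega>\<close> is 1 only for \<open>i = l\<close>; otherwise the geometric sum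
  vanishes.\<close>

lemma sum_root_unity_powers:
  fixes M i l :: nat
  assumes "i < M" "l < M"
  shows "(\<Sum>j<M. cis (2 * pi * j / M) ^ i * cnj (cis (2 * pi * j / M) ^ l)) = (if i = l then of_nat M else 0)"
proof -
  define \<omega> where "\<omega> = cis (2 * pi * i / M) * cnj (cis (2 * pi * l / M))"
  have M: "M > 0" using assms by simp
  have eq: "cis (2 * pi * j / M) ^ i * cnj (cis (2 * pi * j / M) ^ l) = \<omega> ^ j" for j :: nat
  proof -
    have swap: "cis (2 * pi * j / M) ^ n = cis (2 * pi * n / M) ^ j" for n :: nat
      unfolding Complex.DeMoivre by (simp add: mult_ac)
    show ?thesis by (simp add: \<omega>_def power_mult_distrib swap)
  qed
  have "\<omega> ^ M = 1"
  proof -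
    have "cis (2 * pi * n / M) ^ M = 1" for n :: nat
    proof -
      have "cis (2 * pi * n / M) ^ M = cis (2 * pi * n)"
        unfolding Complex.DeMoivre using M by simp
      then show ?thesis by (simp add: cis_multiple_2pi)
    qed
    then show ?thesis by (simp add: \<omega>_def power_mult_distrib flip: complex_cnj_power)
  qed
  moreover have "\<omega> = 1 \<longleftrightarrow> i = l"
  proof
    assume "\<omega> = 1"
    then have "\<omega> * cis (2 * pi * l / M) = cis (2 * pi * l / M)" by simp
    then have "cis (2 * pi * i / M) = cis (2 * pi * l / M)"
      by (simp add: \<omega>_def cis_cnj cis_mult)
    then have "exp (2 * of_real pi * \<i> * of_nat i / of_nat M) = exp (2 * of_real pi * \<i> * of_nat l / of_nat M)"
      by (simp add: cis_conv_exp mult_ac)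
    then show "i = l"
      using M assms by (subst (asm) complex_root_unity_eq) (auto simp: mod_less)
  next
    assume "i = l" then show "\<omega> = 1" by (simp add: \<omega>_def cis_cnj cis_mult)
  qed
  ultimately show ?thesis
    unfolding eq by (cases "i = l") (simp_all add: geometric_sum)
qed

text \<open>Orthogonality of the powers on the \<open>M\<close>-th roots of unity leaves only the
  diagonal of the expanded square. The bound \<open>degree P < M\<close> excludes aliasing.\<close>

lemma discrete_Parseval:
  assumes "degree P < M"
  shows "(\<Sum>j<M. (cmod (poly P (cis (2 * pi * real j / real M))))\<^sup>2) = real M * coeff_sqnorm P"
proof -
  define z where "z j = cis (2 * pi * real j / real M)" for j
  let ?D = "degree P"
  have "complex_of_real (\<Sum>j<M. (cmod (poly P (z j)))\<^sup>2)
      = (\<Sum>j<M. \<Sum>i\<le>?D. \<Sum>l\<le>?D. coeff P i * cnj (coeff P l) * (z j ^ i * cnj (z j ^ l)))"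
    unfolding of_real_sum complex_norm_square poly_altdef cnj_sum sum_product
    by (intro sum.cong refl) (simp add: mult_ac)
  also have "\<dots> = (\<Sum>i\<le>?D. \<Sum>l\<le>?D. \<Sum>j<M. coeff P i * cnj (coeff P l) * (z j ^ i * cnj (z j ^ l)))"
    by (subst sum.swap, rule sum.cong[OF refl], rule sum.swap)
  also have "\<dots> = (\<Sum>i\<le>?D. \<Sum>l\<le>?D. if l = i then of_nat M * (coeff P i * cnj (coeff P i)) else 0)"
    unfolding sum_distrib_left[symmetric] z_def
    using assms by (intro sum.cong refl, subst sum_root_unity_powers) auto
  also have "\<dots> = of_real (real M * coeff_sqnorm P)"
    by (simp add: coeff_sqnorm_def sum_distrib_left complex_norm_square[symmetric])
  finally show ?thesis by (simp only: of_real_eq_iff z_def)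
qed

text \<open>On the circle \<open>P\<close> is bounded by the sum \<open>S\<close> of its coefficient
  moduli and Lipschitz with constant \<open>S * N\<close>. Cauchy-Schwarz bounds the square of
  \<open>S\<close> by \<open>N + 1\<close> times the coefficient form, and the remaining
  \<open>N\<close> is rounded up to \<open>N + 1\<close>.\<close>

lemma cmod_poly_square_diff_le:
  assumes "cmod z = 1" "cmod u = 1" "degree P \<le> N"
  shows "\<bar>(cmod (poly P z))\<^sup>2 - (cmod (poly P u))\<^sup>2\<bar> \<le> 2 * (real N + 1)\<^sup>2 * cmod (z - u) * coeff_sqnorm P"
proof -
  define S where "S = (\<Sum>i\<le>degree P. cmod (coeff P i))"
  have S0: "0 \<le> S" by (simp add: S_def sum_nonneg)
  have le_S: "cmod (poly P x) \<le> S" if "cmod x = 1" for x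
    unfolding poly_altdef S_def using that
    by (intro order_trans[OF norm_sum]) (simp add: norm_mult norm_power)
  have "cmod (poly P z - poly P u) = cmod (\<Sum>i\<le>degree P. coeff P i * (z ^ i - u ^ i))"
    by (simp add: poly_altdef sum_subtractf right_diff_distrib)
  also have "\<dots> \<le> (\<Sum>i\<le>degree P. cmod (coeff P i) * (real N * cmod (z - u)))"
  proof (intro order_trans[OF norm_sum] sum_mono)
    fix i assume "i \<in> {..degree P}"
    then have "cmod (z ^ i - u ^ i) \<le> real N * cmod (z - u)"
      using assms by (intro order_trans[OF norm_power_diff] mult_right_mono) auto
    then show "cmod (coeff P i * (z ^ i - u ^ i)) \<le> cmod (coeff P i) * (real N * cmod (z - u))"
      by (simp add: norm_mult mult_left_mono)
  qed
  also have "\<dots> = S * (real N * cmod (z - u))"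
    by (simp add: S_def sum_distrib_right)
  finally have diff: "cmod (poly P z - poly P u) \<le> S * (real N * cmod (z - u))" .
  have "\<bar>(cmod (poly P z))\<^sup>2 - (cmod (poly P u))\<^sup>2\<bar>
      = (cmod (poly P z) + cmod (poly P u)) * \<bar>cmod (poly P z) - cmod (poly P u)\<bar>"
    by (simp add: power2_eq_square square_diff_square_factored abs_mult)
  also have "\<dots> \<le> (S + S) * (S * (real N * cmod (z - u)))"
    by (intro mult_mono add_mono le_S assms order_trans[OF norm_triangle_ineq3 diff]) (auto simp: S0)
  also have "\<dots> = 2 * real N * cmod (z - u) * S\<^sup>2"
    by (simp add: power2_eq_square)
  also have "\<dots> \<le> 2 * real N * cmod (z - u) * ((real N + 1) * coeff_sqnorm P)"
  proof (intro mult_left_mono)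
    have "S\<^sup>2 \<le> (\<Sum>i\<le>degree P. (cmod (coeff P i))\<^sup>2) * card {..degree P}"
      unfolding S_def by (rule sum_squared_le_sum_of_squares)
    also have "\<dots> \<le> coeff_sqnorm P * (real N + 1)"
      unfolding coeff_sqnorm_def[symmetric]
      using assms by (intro mult_left_mono coeff_sqnorm_nonneg) simp
    finally show "S\<^sup>2 \<le> (real N + 1) * coeff_sqnorm P" by (simp add: mult.commute)
  qed auto
  also have "\<dots> \<le> 2 * (real N + 1) * cmod (z - u) * ((real N + 1) * coeff_sqnorm P)"
    by (intro mult_right_mono) (auto simp: coeff_sqnorm_nonneg)
  also have "\<dots> = 2 * (real N + 1)\<^sup>2 * cmod (z - u) * coeff_sqnorm P"
    by (simp only: power2_eq_square mult_ac)
  finally show ?thesis .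
qed

section \<open>Weights that imitate Lebesgue measure in bounded degree\<close>

lemma integrable_circle_real:
  fixes f :: "complex \<Rightarrow> real"
  assumes "circle_prob_measure M" "continuous_on UNIV f"
  shows "integrable M f"
  using integrable_circle[OF assms(1), of "\<lambda>z. of_real (f z)"] assms(2)
  by (simp add: complex_of_real_integrable_eq continuous_on_of_real)

lemma borel_measurable_poly_sq:
  assumes "circle_prob_measure M"
  shows "(\<lambda>z. (cmod (poly P z))\<^sup>2) \<in> borel_measurable M"
  by (intro borel_measurable_integrable integrable_circle_real[OF assms] continuous_intros)

lemma cmod_poly_sq_bounded:
  obtains B where "0 \<le> B" "\<And>z. cmod z = 1 \<Longrightarrow> (cmod (poly P z))\<^sup>2 \<le> B"
proof -
  have "compact ((\<lambda>z. (cmod (poly P z))\<^sup>2) ` sphere 0 1)"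
    by (intro compact_continuous_image continuous_intros) auto
  then obtain B where B: "\<forall>x\<in>(\<lambda>z. (cmod (poly P z))\<^sup>2) ` sphere 0 1. norm x \<le> B"
    using compact_imp_bounded bounded_iff by metis
  show thesis
  proof (rule that[of "\<bar>B\<bar>"])
    fix z :: complex assume "cmod z = 1"
    then have "z \<in> sphere 0 1" by simp
    then have "norm ((cmod (poly P z))\<^sup>2) \<le> B" using B by blast
    then show "(cmod (poly P z))\<^sup>2 \<le> \<bar>B\<bar>" by simp
  qed simp
qed

text \<open>The weight is the average of the normalized indicators of small arcs about the
  \<open>(N + 1)\<close>-th roots of unity; full support gives every arc positive mass. The integral
  is then close to the mean over the roots of unity, which discrete Parseval identifies with
  \<open>coeff_sqnorm P\<close>.\<close>

lemma exists_weight: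
  assumes \<mu>: "circle_prob_measure \<mu>" and supp: "supp_measure \<mu> = sphere 0 1" and "0 < \<eta>"
  shows "\<exists>w. w \<in> borel_measurable \<mu> \<and> (\<forall>z. 0 \<le> w z) \<and> integrable \<mu> w \<and> (LINT z|\<mu>. w z) = 1 \<and>
    (\<forall>P. degree P \<le> N \<longrightarrow>
      \<bar>(LINT z|\<mu>. w z * (cmod (poly P z))\<^sup>2) - coeff_sqnorm P\<bar> \<le> \<eta> * coeff_sqnorm P)"
proof -
  interpret prob_space \<mu> by (rule circle_prob_measureD[OF \<mu>])
  define M where "M = Suc N"
  \<comment> \<open>This radius makes the Lipschitz bound over one arc equal to
    \<open>\<eta> * coeff_sqnorm P\<close>.\<close>
  define r where "r = \<eta> / (2 * (real N + 1)\<^sup>2)"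
  define u where "u j = cis (2 * pi * real j / real M)" for j
  define B where "B j = ball (u j) r \<inter> sphere 0 1" for j
  define m where "m j = measure \<mu> (B j)" for j
  define w where "w z = (\<Sum>j<M. indicator (B j) z / (real M * m j))" for z
  have M: "real M > 0" by (simp add: M_def)
  have r: "r > 0" using assms by (simp add: r_def)
  have B[measurable]: "B j \<in> sets \<mu>" for j
    by (auto simp: B_def circle_prob_measureD(3)[OF \<mu>] sets_restrict_space_iff)
  have m: "m j > 0" for j
  proof -
    have "u j \<in> supp_measure \<mu>" by (simp add: supp u_def)
    then have "emeasure \<mu> (ball (u j) r \<inter> space \<mu>) > 0"
      using r by (auto simp: supp_measure_def)
    then show ?thesis
      by (simp add: m_def B_def circle_prob_measureD(2)[OF \<mu>] emeasure_eq_measure)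
  qed
  have int_ind: "integrable \<mu> (\<lambda>z. indicator (B j) z * f z)" if "integrable \<mu> f" for j and f :: "complex \<Rightarrow> real"
    using integrable_mult_indicator[OF B that] by simp
  have int_w: "(LINT z|\<mu>. w z * f z) = (\<Sum>j<M. (LINT z|\<mu>. indicator (B j) z * f z) / m j) / M"
    if f: "integrable \<mu> f" for f
  proof -
    have "w z * f z = (\<Sum>j<M. indicator (B j) z * f z / (real M * m j))" for z
      by (simp add: w_def sum_distrib_right)
    then have "(LINT z|\<mu>. w z * f z) = (LINT z|\<mu>. (\<Sum>j<M. indicator (B j) z * f z / (real M * m j)))"
      by simp
    also have "\<dots> = (\<Sum>j<M. (LINT z|\<mu>. indicator (B j) z * f z / (real M * m j)))"
      by (intro Bochner_Integration.integral_sum integrable_divide_zero int_ind f)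
    finally show ?thesis by (simp add: sum_divide_distrib mult.commute)
  qed
  show ?thesis
  proof (intro exI[of _ w] conjI allI impI)
    show "w \<in> borel_measurable \<mu>" unfolding w_def by measurable
    show "0 \<le> w z" for z
      unfolding w_def using m by (intro sum_nonneg) (auto simp: less_imp_le)
    show "integrable \<mu> w"
      unfolding w_def by (intro Bochner_Integration.integrable_sum integrable_divide_zero) (simp add: emeasure_eq_measure)
    show "(LINT z|\<mu>. w z) = 1"
    proof -
      have one: "(LINT z|\<mu>. indicator (B j) z * (1 :: real)) / m j = 1" for j
        using m[of j] by (simp add: m_def)
      have "(LINT z|\<mu>. w z * 1) = 1" unfolding int_w[OF integrable_const] one using M by simp
      then show ?thesis by simp
    qed
    fix P :: "complex poly" assume deg: "degree P \<le> N"
    define f where "f z = (cmod (poly P z))\<^sup>2" for z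
    have f: "integrable \<mu> f"
      unfolding f_def by (intro integrable_circle_real[OF \<mu>] continuous_intros)
    \<comment> \<open>The mean over an arc differs from the value at the centre by at most the
      Lipschitz bound over that arc.\<close>
    have *: "\<bar>(LINT z|\<mu>. indicator (B j) z * f z) / m j - f (u j)\<bar> \<le> \<eta> * coeff_sqnorm P" for j
    proof -
      have i: "integrable \<mu> (\<lambda>z. f z - f (u j))" using f by simp
      have i2: "integrable \<mu> (\<lambda>z. indicator (B j) z * f (u j))"
        by (rule int_ind) simp
      have "(LINT z|\<mu>. indicator (B j) z * f z) - f (u j) * m j
          = (LINT z|\<mu>. indicator (B j) z * f z - indicator (B j) z * f (u j))"
        by (subst Bochner_Integration.integral_diff[OF int_ind[OF f] i2]) (simp add: m_def mult.commute)
      also have "\<dots> = (LINT z|\<mu>. indicator (B j) z * (f z - f (u j)))"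
        by (simp add: right_diff_distrib)
      also have "\<bar>\<dots>\<bar> \<le> (LINT z|\<mu>. \<bar>indicator (B j) z * (f z - f (u j))\<bar>)"
        by (rule integral_abs_bound)
      also have "\<dots> \<le> (LINT z|\<mu>. indicator (B j) z * (\<eta> * coeff_sqnorm P))"
      proof (intro integral_mono integrable_abs int_ind i integrable_const)
        fix z assume "z \<in> space \<mu>"
        show "\<bar>indicator (B j) z * (f z - f (u j))\<bar> \<le> indicator (B j) z * (\<eta> * coeff_sqnorm P)"
        proof (cases "z \<in> B j")
          case True
          then have z: "cmod z = 1" "cmod (z - u j) \<le> r"
            by (auto simp: B_def dist_norm norm_minus_commute)
          have "\<bar>f z - f (u j)\<bar> \<le> 2 * (real N + 1)\<^sup>2 * cmod (z - u j) * coeff_sqnorm P"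
            unfolding f_def by (intro cmod_poly_square_diff_le z deg) (simp add: u_def)
          also have "\<dots> \<le> 2 * (real N + 1)\<^sup>2 * r * coeff_sqnorm P"
            using z by (intro mult_right_mono mult_left_mono coeff_sqnorm_nonneg) auto
          also have "2 * (real N + 1)\<^sup>2 * r = \<eta>"
            by (simp add: r_def add_nonneg_eq_0_iff)
          finally show ?thesis using True by simp
        qed simp
      qed
      also have "\<dots> = m j * (\<eta> * coeff_sqnorm P)" by (simp add: m_def)
      finally have "\<bar>(LINT z|\<mu>. indicator (B j) z * f z) - f (u j) * m j\<bar> / m j \<le> \<eta> * coeff_sqnorm P"
        using m[of j] by (simp add: divide_simps mult.commute)
      moreover have "\<bar>(LINT z|\<mu>. indicator (B j) z * f z) - f (u j) * m j\<bar> / m j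
          = \<bar>((LINT z|\<mu>. indicator (B j) z * f z) - f (u j) * m j) / m j\<bar>"
        using m[of j] by simp
      ultimately show ?thesis
        using m[of j] by (simp add: diff_divide_distrib)
    qed
    have "coeff_sqnorm P = (\<Sum>j<M. f (u j)) / M"
      using discrete_Parseval[of P M] deg M by (simp add: f_def u_def M_def)
    then have "(LINT z|\<mu>. w z * f z) - coeff_sqnorm P
        = (\<Sum>j<M. (LINT z|\<mu>. indicator (B j) z * f z) / m j - f (u j)) / M"
      by (simp add: int_w[OF f] sum_subtractf diff_divide_distrib)
    also have "\<bar>\<dots>\<bar> \<le> (\<Sum>j<M. \<eta> * coeff_sqnorm P) / M"
      unfolding abs_divide using *
      by (intro divide_mono order_trans[OF sum_abs] sum_mono) (auto simp: M_def)
    also have "\<dots> = \<eta> * coeff_sqnorm P" using M by simp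
    finally show "\<bar>(LINT z|\<mu>. w z * (cmod (poly P z))\<^sup>2) - coeff_sqnorm P\<bar> \<le> \<eta> * coeff_sqnorm P"
      by (simp only: f_def)
  qed
qed

section \<open>Extremal property of the orthogonal polynomials and Verblunsky coefficients\<close>

definition L2_sq :: "complex measure \<Rightarrow> complex poly \<Rightarrow> real" where
  "L2_sq M P = (LINT z|M. (cmod (poly P z))\<^sup>2)"

lemma L2_sq_nonneg: "0 \<le> L2_sq M P"
  by (simp add: L2_sq_def)

lemma L2_sq_cong:
  assumes "circle_prob_measure M" "\<And>z. cmod z = 1 \<Longrightarrow> cmod (poly P z) = cmod (poly R z)"
  shows "L2_sq M P = L2_sq M R"
  unfolding L2_sq_def
  by (intro Bochner_Integration.integral_cong refl) (simp add: assms circle_prob_measureD(2)[OF assms(1)])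

lemma L2_sq_Pythagoras:
  assumes M: "circle_prob_measure M" and orth: "(LINT z|M. cnj (poly q z) * poly p z) = 0"
  shows "L2_sq M (p + q) = L2_sq M p + L2_sq M q"
proof -
  have int: "integrable M (\<lambda>z. (cmod (poly p z))\<^sup>2)" for p
    by (intro integrable_circle_real[OF M] continuous_intros)
  have int2: "integrable M (\<lambda>z. cnj (poly q z) * poly p z)"
    by (intro integrable_circle[OF M] continuous_intros)
  define h where "h z = Re (cnj (poly q z) * poly p z)" for z
  have h: "integrable M h" "(LINT z|M. h z) = 0"
    using integrable_Re[OF int2] integral_Re[OF int2] orth by (simp_all only: h_def[abs_def] complex.sel zero_complex.sel)
  have "(cmod (poly (p + q) z))\<^sup>2
      = (cmod (poly p z))\<^sup>2 + (cmod (poly q z))\<^sup>2 + 2 * h z" for z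
    unfolding cmod_power2 h_def by (simp add: power2_eq_square algebra_simps)
  then have "L2_sq M (p + q) = (LINT z|M. (cmod (poly p z))\<^sup>2 + (cmod (poly q z))\<^sup>2 + 2 * h z)"
    by (simp add: L2_sq_def)
  also have "\<dots> = L2_sq M p + L2_sq M q"
    using int h by (simp add: L2_sq_def)
  finally show ?thesis .
qed

text \<open>\<open>P - \<Phi>\<close> has degree below \<open>n\<close>, hence is orthogonal to
  \<open>\<Phi>\<close>, and Pythagoras applies.\<close>

lemma monic_orthogonal_minimal:
  assumes M: "circle_prob_measure M" and \<Phi>: "is_monic_orthogonal M n \<Phi>" and "degree P \<le> n" "coeff P n = 1"
  shows "L2_sq M \<Phi> \<le> L2_sq M P"
proof -
  have "(LINT z|M. cnj (poly (P - \<Phi>) z) * poly \<Phi> z) = 0"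
  \<comment> \<open>The zero difference is split off because its degree 0 is not below
    \<open>n\<close> when \<open>n = 0\<close>.\<close>
  proof (cases "P = \<Phi>")
    case False
    have "degree (P - \<Phi>) < n"
    proof (intro degree_lessI allI impI)
      fix k assume "n \<le> k"
      then show "coeff (P - \<Phi>) k = 0"
        using assms by (cases "k = n") (auto simp: is_monic_orthogonal_def coeff_eq_0)
    qed (use False in simp)
    with \<Phi> show ?thesis by (simp add: is_monic_orthogonal_def del: poly_diff)
  qed simp
  from L2_sq_Pythagoras[OF M this] show ?thesis
    using L2_sq_nonneg[of M "P - \<Phi>"] by simp
qed

text \<open>Dividing \<open>P\<close> by its coefficient at \<open>n\<close> yields a competitor for
  the minimum; if that coefficient vanishes, the bound is trivial.\<close>

lemma monic_orthogonal_top_coeff_le: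
  assumes M: "circle_prob_measure M" and \<Phi>: "is_monic_orthogonal M n \<Phi>" and "degree P \<le> n"
  shows "(cmod (coeff P n))\<^sup>2 * L2_sq M \<Phi> \<le> L2_sq M P"
proof (cases "coeff P n = 0")
  case False
  have "L2_sq M \<Phi> \<le> L2_sq M (smult (inverse (coeff P n)) P)"
    using False assms by (intro monic_orthogonal_minimal[OF M \<Phi>]) auto
  also have "\<dots> = L2_sq M P / (cmod (coeff P n))\<^sup>2"
    by (simp add: L2_sq_def norm_mult power_mult_distrib norm_inverse power_inverse divide_inverse mult.commute)
  finally show ?thesis using False by (simp add: field_simps)
qed (simp add: L2_sq_nonneg)

text \<open>Passing to the reversed polynomial keeps the modulus on the circle and swaps the lowest with the top coefficient.\<close>

lemma monic_orthogonal_value_at_0_le: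
  assumes M: "circle_prob_measure M" and \<Phi>: "is_monic_orthogonal M n \<Phi>" and deg: "degree R \<le> n"
  shows "(cmod (poly R 0))\<^sup>2 * L2_sq M \<Phi> \<le> L2_sq M R"
proof -
  \<comment> \<open>\<open>reflect_poly\<close> reverses with respect to the actual degree of
    \<open>R\<close>; the extra power of \<open>z\<close> moves the conjugated constant coefficient
    up to position \<open>n\<close>.\<close>
  define S where "S = monom 1 (n - degree R) * map_poly cnj (reflect_poly R)"
  have degS: "degree S \<le> n"
  proof -
    have "degree S \<le> (n - degree R) + degree R"
      unfolding S_def
      by (intro order_trans[OF degree_mult_le] add_mono degree_monom_le)
        (simp add: degree_map_poly degree_reflect_poly_le)
    then show ?thesis using deg by simp
  qed
  have "coeff S n = cnj (coeff R 0)"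
    using deg by (simp add: S_def coeff_monom_mult coeff_map_poly coeff_reflect_poly)
  moreover have "L2_sq M S = L2_sq M R"
  proof (rule L2_sq_cong[OF M])
    fix z :: complex assume z: "cmod z = 1"
    then have nz: "cnj z \<noteq> 0" by auto
    have "inverse (cnj z) = z"
      using z complex_norm_square[of z] nz by (simp add: field_simps)
    moreover have "poly (map_poly cnj p) z = cnj (poly p (cnj z))" for p
      by (induction p) (auto simp: map_poly_pCons)
    ultimately show "cmod (poly S z) = cmod (poly R z)"
      using z nz by (simp add: S_def poly_monom norm_mult norm_power poly_reflect_poly_nz)
  qed
  ultimately show ?thesis
    using monic_orthogonal_top_coeff_le[OF M \<Phi> degS] by (simp add: poly_0_coeff_0)
qed

text \<open>Multiplication by \<open>z\<close> preserves the norm, and \<open>R\<close>, having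
  degree at most \<open>n\<close>, is orthogonal to the next orthogonal polynomial. By Pythagoras
  the drop of the minima is therefore the squared norm of \<open>R\<close>, which is bounded below
  through the value of \<open>R\<close> at 0, of the same modulus as the Verblunsky
  coefficient.\<close>

lemma cmod_verblunsky_le:
  assumes M: "circle_prob_measure M" and \<Phi>: "\<And>n. is_monic_orthogonal M n (opuc M n)"
  shows "(cmod (verblunsky M n))\<^sup>2 * L2_sq M (opuc M n) \<le> L2_sq M (opuc M n) - L2_sq M (opuc M (Suc n))"
proof -
  define R where "R = pCons 0 (opuc M n) - opuc M (Suc n)"
  have d: "degree (opuc M k) = k" "coeff (opuc M k) k = 1" for k
    using \<Phi>[of k] by (auto simp: is_monic_orthogonal_def)
  have deg: "degree R < Suc n"
  proof (intro degree_lessI allI impI)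
    fix k assume "Suc n \<le> k"
    then show "coeff R k = 0"
      by (cases "k = Suc n") (auto simp: R_def d coeff_eq_0 coeff_pCons split: nat.splits)
  qed simp
  then have "(LINT z|M. cnj (poly R z) * poly (opuc M (Suc n)) z) = 0"
    using \<Phi>[of "Suc n"] by (simp add: is_monic_orthogonal_def)
  from L2_sq_Pythagoras[OF M this]
  have "L2_sq M (pCons 0 (opuc M n)) = L2_sq M (opuc M (Suc n)) + L2_sq M R"
    by (simp add: R_def)
  moreover have "L2_sq M (pCons 0 (opuc M n)) = L2_sq M (opuc M n)"
    by (rule L2_sq_cong[OF M]) (simp add: norm_mult)
  moreover have "(cmod (poly R 0))\<^sup>2 * L2_sq M (opuc M n) \<le> L2_sq M R"
    using deg by (intro monic_orthogonal_value_at_0_le[OF M \<Phi>]) simp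
  moreover have "cmod (poly R 0) = cmod (verblunsky M n)"
    by (simp add: R_def verblunsky_def)
  ultimately show ?thesis by simp
qed

section \<open>From squares over blocks to \<open>p\<close>-th powers\<close>

text \<open>With \<open>c = C / (k + 2)\<close>, every square in block \<open>k\<close> is at most
  \<open>c\<close>, so each \<open>p\<close>-th power is at most the square times
  \<open>c powr (p / 2 - 1)\<close>. The block contributes at most \<open>c powr (p / 2)\<close>,
  which is summable over \<open>k\<close> since \<open>p / 2 > 1\<close>.\<close>

lemma summable_powr_of_block_squares:
  fixes a :: "nat \<Rightarrow> real" and N :: "nat \<Rightarrow> nat"
  assumes a: "\<And>n. 0 \<le> a n" and N: "strict_mono N"
    and block: "\<And>k. (\<Sum>n = N k..<N (Suc k). (a n)\<^sup>2) \<le> C / (real k + 2)" and p: "p > 2"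
  shows "summable (\<lambda>n. a n powr p)"
proof -
  have C: "0 \<le> C"
    using order_trans[OF sum_nonneg block[of 0]] by simp
  define b where "b k = (C / (real k + 2)) powr (p / 2)" for k :: nat
  have block_p: "(\<Sum>n = N k..<N (Suc k). a n powr p) \<le> b k" for k
  proof -
    define c where "c = C / (real k + 2)"
    have c: "0 \<le> c" using C by (simp add: c_def)
    have "(\<Sum>n = N k..<N (Suc k). a n powr p) \<le> (\<Sum>n = N k..<N (Suc k). (a n)\<^sup>2 * c powr (p / 2 - 1))"
    proof (rule sum_mono)
      fix n assume n: "n \<in> {N k..<N (Suc k)}"
      have "(a n)\<^sup>2 \<le> c"
        using n unfolding c_def by (intro order_trans[OF member_le_sum block]) auto
      then have le: "((a n)\<^sup>2) powr (p / 2 - 1) \<le> c powr (p / 2 - 1)"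
        using p by (intro powr_mono2) auto
      show "a n powr p \<le> (a n)\<^sup>2 * c powr (p / 2 - 1)"
      proof (cases "a n = 0")
        case False
        then have pos: "0 < a n" using a[of n] by simp
        have "a n powr p = (a n powr 2) powr (p / 2)" by (simp add: powr_powr)
        also have "\<dots> = ((a n)\<^sup>2) powr (1 + (p / 2 - 1))" using pos by simp
        also have "\<dots> = (a n)\<^sup>2 * ((a n)\<^sup>2) powr (p / 2 - 1)" using pos by (subst powr_add) simp
        finally show ?thesis using le by (simp add: mult_left_mono)
      qed simp
    qed
    also have "\<dots> = (\<Sum>n = N k..<N (Suc k). (a n)\<^sup>2) * c powr (p / 2 - 1)"
      by (simp add: sum_distrib_right)
    also have "\<dots> \<le> c * c powr (p / 2 - 1)"
      using block by (intro mult_right_mono) (auto simp: c_def)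
    also have "\<dots> = b k"
    proof (cases "c = 0")
      case False
      then have "c * c powr (p / 2 - 1) = c powr (1 + (p / 2 - 1))"
        using c by (subst powr_add) simp
      then show ?thesis by (simp add: b_def c_def)
    qed (use p in \<open>simp add: b_def flip: c_def\<close>)
    finally show ?thesis .
  qed
  have sum_b: "summable b"
  proof -
    have "summable (\<lambda>k. real (k + 2) powr - (p / 2))"
      using p by (subst summable_iff_shift) (simp add: summable_real_powr_iff)
    then have "summable (\<lambda>k. C powr (p / 2) * real (k + 2) powr - (p / 2))"
      by (rule summable_mult)
    moreover have "b = (\<lambda>k. C powr (p / 2) * real (k + 2) powr - (p / 2))"
      unfolding b_def powr_minus_divide using C
      by (intro ext, subst powr_divide) (simp_all add: add.commute)
    ultimately show ?thesis by (simp only:)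
  qed
  \<comment> \<open>Indices below \<open>N 0\<close> belong to no block and contribute a fixed
    finite sum.\<close>
  have le_sum: "(\<Sum>n<N k. a n powr p) \<le> (\<Sum>n<N 0. a n powr p) + (\<Sum>j<k. b j)" for k
  proof (induction k)
    case (Suc k)
    have "(\<Sum>n<N (Suc k). a n powr p) = (\<Sum>n<N k. a n powr p) + (\<Sum>n = N k..<N (Suc k). a n powr p)"
      using strict_monoD[OF N, of k "Suc k"] unfolding lessThan_atLeast0
      by (subst sum.atLeastLessThan_concat) auto
    with Suc block_p[of k] show ?case by simp
  qed simp
  show ?thesis
  proof (rule bounded_imp_summable)
    fix n
    have "(\<Sum>i\<le>n. a i powr p) \<le> (\<Sum>i<N (Suc n). a i powr p)"
      using strict_mono_imp_increasing[OF N, of "Suc n"] by (intro sum_mono2) auto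
    also have "\<dots> \<le> (\<Sum>n<N 0. a n powr p) + suminf b"
      using le_sum[of "Suc n"] sum_le_suminf[OF sum_b, of "{..<Suc n}"] by (simp add: b_def)
    finally show "(\<Sum>i\<le>n. a i powr p) \<le> (\<Sum>n<N 0. a n powr p) + suminf b" .
  qed simp
qed

section \<open>Staged replacement of the Lebesgue part\<close>

text \<open>The Lebesgue mass still unspent at stage \<open>k\<close>, starting from one half;
  \<open>piece_mass k\<close> is what that stage spends. The same number serves as the error
  tolerance of the stage.\<close>

definition tail_mass :: "nat \<Rightarrow> real" where
  "tail_mass k = 1 / (real k + 2)"

definition piece_mass :: "nat \<Rightarrow> real" where
  "piece_mass k = tail_mass k - tail_mass (Suc k)"

lemma tail_mass_pos: "0 < tail_mass k"
  by (simp add: tail_mass_def)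

lemma tail_mass_antimono: "j \<le> k \<Longrightarrow> tail_mass k \<le> tail_mass j"
  by (simp add: tail_mass_def frac_le)

lemma piece_mass_nonneg: "0 \<le> piece_mass k"
  using tail_mass_antimono[of k "Suc k"] by (simp add: piece_mass_def)

lemma piece_mass_sums: "(\<lambda>j. piece_mass (j + k)) sums tail_mass k"
proof -
  have "tail_mass \<longlonglongrightarrow> 0"
    unfolding tail_mass_def by real_asymp
  then have "(\<lambda>j. tail_mass (j + k)) \<longlonglongrightarrow> 0"
    by (rule LIMSEQ_ignore_initial_segment)
  from telescope_sums'[OF this] show ?thesis by (simp add: piece_mass_def)
qed

definition approx_coeff_sqnorm :: "(complex poly \<Rightarrow> real) \<Rightarrow> nat \<Rightarrow> real \<Rightarrow> bool" where
  "approx_coeff_sqnorm V N \<eta> \<longleftrightarrow>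
     (\<forall>P. degree P \<le> N \<longrightarrow> \<bar>V P - coeff_sqnorm P\<bar> \<le> \<eta> * coeff_sqnorm P)"

text \<open>Monic polynomials of all degrees compete, so for a form \<open>F\<close> given by a
  measure this is the limit of the degree-\<open>n\<close> minima of the stage-\<open>k\<close>
  form.\<close>

definition monic_inf :: "(complex poly \<Rightarrow> real) \<Rightarrow> nat \<Rightarrow> real" where
  "monic_inf F k = (INF P\<in>{P. lead_coeff P = 1}. F P + tail_mass k * coeff_sqnorm P)"

text \<open>A monic polynomial has \<open>coeff_sqnorm\<close> at least 1, so the Lebesgue part
  keeps the infimum above \<open>tail_mass k\<close>. Being positive, it grows strictly under the
  factor \<open>1 + tail_mass k\<close>, which leaves room for a near-minimizer.\<close>

lemma
  assumes F: "\<And>P. 0 \<le> F P"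
  shows monic_inf_pos: "0 < monic_inf F k"
    and monic_inf_le: "lead_coeff P = 1 \<Longrightarrow> monic_inf F k \<le> F P + tail_mass k * coeff_sqnorm P"
    and near_minimizer_exists:
      "\<exists>P. lead_coeff P = 1 \<and> F P + tail_mass k * coeff_sqnorm P \<le> (1 + tail_mass k) * monic_inf F k"
proof -
  let ?Q = "\<lambda>P. F P + tail_mass k * coeff_sqnorm P"
  let ?M = "{P :: complex poly. lead_coeff P = 1}"
  have ge: "tail_mass k \<le> ?Q P" if "P \<in> ?M" for P
  proof -
    have "tail_mass k * 1 \<le> tail_mass k * coeff_sqnorm P"
      using that tail_mass_pos[of k] by (intro mult_left_mono coeff_sqnorm_monic_ge_1) auto
    with F[of P] show ?thesis by simp
  qed
  have ne: "?Q ` ?M \<noteq> {}" by (auto intro!: exI[of _ 1])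
  have bdd: "bdd_below (?Q ` ?M)" using ge by (intro bdd_belowI2)
  have "tail_mass k \<le> monic_inf F k"
    unfolding monic_inf_def using ne ge by (intro cINF_greatest) auto
  then show pos: "0 < monic_inf F k" using tail_mass_pos[of k] by simp
  show "lead_coeff P = 1 \<Longrightarrow> monic_inf F k \<le> ?Q P"
    unfolding monic_inf_def by (intro cINF_lower bdd) simp
  have "Inf (?Q ` ?M) < (1 + tail_mass k) * monic_inf F k"
    using mult_pos_pos[OF tail_mass_pos[of k] pos] by (simp add: monic_inf_def distrib_right)
  from cInf_lessD[OF ne this] show "\<exists>P. lead_coeff P = 1 \<and> ?Q P \<le> (1 + tail_mass k) * monic_inf F k"
    by (auto intro: less_imp_le)
qed

text \<open>The stage-\<open>k\<close> form is \<open>F k + tail_mass k * coeff_sqnorm\<close>, where the second summand stands for a multiple of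
  Lebesgue measure still to be spent. Since \<open>N k\<close> is chosen after \<open>F k\<close> but before the piece \<open>w k\<close>, the
  limit form \<open>Q\<close> agrees with it up to a factor \<open>1 \<plusminus> tail_mass k\<close> in degrees up to \<open>N k\<close>.\<close>

lemma staged_approximation:
  fixes W :: "'w \<Rightarrow> complex poly \<Rightarrow> real"
  assumes F0: "\<And>P. 0 \<le> F0 P"
    and W: "\<And>w P. w \<in> A \<Longrightarrow> 0 \<le> W w P"
    and ex: "\<And>N \<eta>. 0 < \<eta> \<Longrightarrow> \<exists>w\<in>A. approx_coeff_sqnorm (W w) N \<eta>"
  obtains N :: "nat \<Rightarrow> nat" and w :: "nat \<Rightarrow> 'w" where
    "strict_mono N" "\<And>k. w k \<in> A"
    "\<And>Q k. (\<And>P. (\<lambda>j. piece_mass j * W (w j) P) sums (Q P - F0 P)) \<Longrightarrow>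
       \<exists>I>0. (\<exists>P. lead_coeff P = 1 \<and> degree P \<le> N k \<and> Q P \<le> (1 + tail_mass k)\<^sup>2 * I) \<and>
         (\<forall>P. lead_coeff P = 1 \<longrightarrow> degree P \<le> N (Suc k) \<longrightarrow>
            (1 - tail_mass (Suc k)) * (tail_mass (Suc k) / tail_mass k) * I \<le> Q P)"
proof -
  \<comment> \<open>\<open>N\<close> is large enough to admit a near-minimizer for \<open>F\<close>,
    and \<open>w\<close> imitates Lebesgue measure up to that degree.\<close>
  define good where "good k F N w \<longleftrightarrow> w \<in> A \<and> approx_coeff_sqnorm (W w) N (tail_mass k) \<and>
      (\<exists>P. lead_coeff P = 1 \<and> degree P \<le> N \<and> F P + tail_mass k * coeff_sqnorm P \<le> (1 + tail_mass k) * monic_inf F k)"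
    for k F N w
  have step: "\<exists>N w. m < N \<and> good k F N w" if F: "\<And>P. 0 \<le> F P" for m k F
  proof -
    obtain P where P: "lead_coeff P = 1"
        "F P + tail_mass k * coeff_sqnorm P \<le> (1 + tail_mass k) * monic_inf F k"
      using near_minimizer_exists[of F, OF F] by blast
    \<comment> \<open>The degree bound \<open>Suc m + degree P\<close> covers the near-minimizer and
      exceeds \<open>m\<close>, which later makes \<open>N\<close> strictly increasing.\<close>
    obtain w where "w \<in> A" "approx_coeff_sqnorm (W w) (Suc m + degree P) (tail_mass k)"
      using ex[OF tail_mass_pos] by blast
    with P have "good k F (Suc m + degree P) w" unfolding good_def by (auto intro!: exI[of _ P])
    then show ?thesis by (intro exI[of _ "Suc m + degree P"] exI[of _ w]) auto
  qed
  \<comment> \<open>A state holds the accumulated form, its degree bound and the next weight; the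
    clause for \<open>k = 0\<close> pins the initial form.\<close>
  define inv where "inv k x \<longleftrightarrow> (case x of (F, N, w) \<Rightarrow> (\<forall>P. 0 \<le> F P) \<and> (k = 0 \<longrightarrow> F = F0) \<and> good k F N w)" for k x
  define nxt where "nxt k x y \<longleftrightarrow> (case x of (F, N, w) \<Rightarrow> case y of (F', N', w') \<Rightarrow>
      F' = (\<lambda>P. F P + piece_mass k * W w P) \<and> N < (N' :: nat))"
    for k :: nat and x :: "(complex poly \<Rightarrow> real) \<times> nat \<times> 'w" and y :: "(complex poly \<Rightarrow> real) \<times> nat \<times> 'w"
  have "\<exists>f. \<forall>k. inv k (f k) \<and> nxt k (f k) (f (Suc k))"
  proof (rule dependent_nat_choice)
    show "\<exists>x. inv 0 x"
      using step[of F0 0 0, OF F0] by (auto simp: inv_def F0)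
    fix x k assume inv: "inv k x"
    obtain F N w where x: "x = (F, N, w)" by (cases x)
    define F' where "F' = (\<lambda>P. F P + piece_mass k * W w P)"
    have F': "0 \<le> F' P" for P
      using inv W[of w P] piece_mass_nonneg[of k] by (auto simp: F'_def x inv_def good_def)
    obtain N' w' where "N < N'" "good (Suc k) F' N' w'" using step[of F', OF F'] by blast
    then show "\<exists>y. inv (Suc k) y \<and> nxt k x y"
      using F' by (intro exI[of _ "(F', N', w')"]) (auto simp: inv_def nxt_def x F'_def)
  qed
  then obtain f where f: "\<And>k. inv k (f k)" "\<And>k. nxt k (f k) (f (Suc k))" by blast
  define F where "F k = fst (f k)" for k
  define N where "N k = fst (snd (f k))" for k
  define w where "w k = snd (snd (f k))" for k
  have fk: "f k = (F k, N k, w k)" for k by (simp add: F_def N_def w_def)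
  have F_nonneg: "0 \<le> F k P" and good: "good k (F k) (N k) (w k)" for k P
    using f(1)[of k] by (auto simp: fk inv_def)
  have F_0: "F 0 = F0" using f(1)[of 0] by (simp add: fk inv_def)
  have F_Suc: "F (Suc k) P = F k P + piece_mass k * W (w k) P" and N_Suc: "N k < N (Suc k)" for k P
    using f(2)[of k] by (auto simp: fk nxt_def)
  have N: "strict_mono N" using N_Suc by (simp add: strict_mono_Suc_iff)
  have F_eq: "F k P = F0 P + (\<Sum>j<k. piece_mass j * W (w j) P)" for k P
    by (induction k) (simp_all add: F_0 F_Suc)
  have wA: "w k \<in> A" for k using good[of k] by (simp add: good_def)
  \<comment> \<open>All pieces from stage \<open>k\<close> on imitate Lebesgue measure in degrees up
    to \<open>N k\<close> with relative error at most \<open>tail_mass k\<close>, and their masses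
    add up to \<open>tail_mass k\<close>. The resulting error is a fraction of the Lebesgue part,
    hence of the whole stage-\<open>k\<close> form.\<close>
  have lim: "\<bar>Q P - (F k P + tail_mass k * coeff_sqnorm P)\<bar> \<le> tail_mass k * (F k P + tail_mass k * coeff_sqnorm P)"
    if sums: "(\<lambda>j. piece_mass j * W (w j) P) sums (Q P - F0 P)" and deg: "degree P \<le> N k" for Q k P
  proof -
    have "(\<lambda>j. piece_mass (j + k) * W (w (j + k)) P) sums (Q P - F k P)"
      using sums_iff_shift[of "\<lambda>j. piece_mass j * W (w j) P" k "Q P - F k P"] sums
      by (simp add: F_eq algebra_simps)
    from sums_diff[OF this sums_mult2[OF piece_mass_sums[of k], of "coeff_sqnorm P"]]
    have s: "(\<lambda>j. piece_mass (j + k) * (W (w (j + k)) P - coeff_sqnorm P)) sums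
        (Q P - (F k P + tail_mass k * coeff_sqnorm P))"
      by (simp add: right_diff_distrib algebra_simps)
    have s2: "(\<lambda>j. piece_mass (j + k) * (tail_mass k * coeff_sqnorm P)) sums (tail_mass k * (tail_mass k * coeff_sqnorm P))"
      by (rule sums_mult2[OF piece_mass_sums])
    have piece: "\<bar>W (w (j + k)) P - coeff_sqnorm P\<bar> \<le> tail_mass k * coeff_sqnorm P" for j
    proof -
      have "N k \<le> N (j + k)" using strict_mono_less_eq[OF N] by simp
      then have "\<bar>W (w (j + k)) P - coeff_sqnorm P\<bar> \<le> tail_mass (j + k) * coeff_sqnorm P"
        using good[of "j + k"] deg by (auto simp: good_def approx_coeff_sqnorm_def)
      also have "\<dots> \<le> tail_mass k * coeff_sqnorm P"
        by (intro mult_right_mono tail_mass_antimono coeff_sqnorm_nonneg) simp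
      finally show ?thesis .
    qed
    have "Q P - (F k P + tail_mass k * coeff_sqnorm P) \<le> tail_mass k * (tail_mass k * coeff_sqnorm P)"
      by (rule sums_le[OF _ s s2]) (intro mult_left_mono piece_mass_nonneg order_trans[OF abs_ge_self piece])
    moreover have "- (Q P - (F k P + tail_mass k * coeff_sqnorm P)) \<le> tail_mass k * (tail_mass k * coeff_sqnorm P)"
      by (rule sums_le[OF _ sums_minus[OF s] s2])
        (auto simp only: mult_minus_right[symmetric] intro!: mult_left_mono piece_mass_nonneg order_trans[OF abs_ge_minus_self piece])
    moreover have "tail_mass k * (tail_mass k * coeff_sqnorm P) \<le> tail_mass k * (F k P + tail_mass k * coeff_sqnorm P)"
      using F_nonneg[of k P] tail_mass_pos[of k] by simp
    ultimately show ?thesis by linarith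
  qed
  show thesis
  proof (rule that[OF N wA])
    fix Q k assume sums: "\<And>P. (\<lambda>j. piece_mass j * W (w j) P) sums (Q P - F0 P)"
    define I where "I = monic_inf (F k) k"
    define t where "t = tail_mass k"
    define s where "s = tail_mass (Suc k)"
    have t: "0 < t" and s: "0 < s" "s \<le> t" "s \<le> 1"
      by (simp_all add: t_def s_def tail_mass_pos tail_mass_antimono) (simp add: tail_mass_def)
    have I: "0 < I" using monic_inf_pos[of "F k", OF F_nonneg] by (simp add: I_def)
    show "\<exists>I>0. (\<exists>P. lead_coeff P = 1 \<and> degree P \<le> N k \<and> Q P \<le> (1 + tail_mass k)\<^sup>2 * I) \<and>
         (\<forall>P. lead_coeff P = 1 \<longrightarrow> degree P \<le> N (Suc k) \<longrightarrow>
            (1 - tail_mass (Suc k)) * (tail_mass (Suc k) / tail_mass k) * I \<le> Q P)"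
      unfolding t_def[symmetric] s_def[symmetric]
    proof (intro exI[of _ I] conjI allI impI I)
      obtain P where P: "lead_coeff P = 1" "degree P \<le> N k" "F k P + t * coeff_sqnorm P \<le> (1 + t) * I"
        using good[of k] by (auto simp: good_def I_def t_def)
      \<comment> \<open>One factor \<open>1 + t\<close> is the cost of passing to the limit form,
        the other that of the near-minimizer.\<close>
      have "Q P \<le> (1 + t) * (F k P + t * coeff_sqnorm P)"
        using lim[where Q = Q, OF sums P(2), folded t_def] by (simp add: abs_le_iff algebra_simps)
      also have "\<dots> \<le> (1 + t) * ((1 + t) * I)"
        using P(3) t by (intro mult_left_mono) auto
      finally show "\<exists>P. lead_coeff P = 1 \<and> degree P \<le> N k \<and> Q P \<le> (1 + t)\<^sup>2 * I"
        using P by (auto simp: power2_eq_square mult.assoc)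
    next
      fix P :: "complex poly" assume P: "lead_coeff P = 1" "degree P \<le> N (Suc k)"
      \<comment> \<open>Passing to the next stage scales the Lebesgue part by \<open>s / t\<close>
        and does not decrease \<open>F\<close>, so the form keeps at least the fraction
        \<open>s / t\<close>. The factor \<open>1 - s\<close> then comes from \<open>lim\<close> at
        stage \<open>Suc k\<close>.\<close>
      have "(s / t) * I \<le> (s / t) * (F k P + t * coeff_sqnorm P)"
        using monic_inf_le[of "F k", OF F_nonneg P(1)] s t by (intro mult_left_mono) (auto simp: I_def t_def)
      also have "\<dots> = (s / t) * F k P + s * coeff_sqnorm P"
        using t by (simp add: distrib_left)
      also have "\<dots> \<le> F (Suc k) P + s * coeff_sqnorm P"
      proof -
        have "(s / t) * F k P \<le> 1 * F k P"
          using s t by (intro mult_right_mono F_nonneg) simp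
        moreover have "0 \<le> piece_mass k * W (w k) P" by (intro mult_nonneg_nonneg piece_mass_nonneg W wA)
        ultimately show ?thesis by (simp add: F_Suc)
      qed
      finally have "(1 - s) * ((s / t) * I) \<le> (1 - s) * (F (Suc k) P + s * coeff_sqnorm P)"
        using s by (intro mult_left_mono) auto
      also have "\<dots> \<le> Q P"
        using lim[where Q = Q, OF sums P(2), folded s_def] by (simp add: abs_le_iff algebra_simps)
      finally show "(1 - s) * (s / t) * I \<le> Q P" by (simp only: mult.assoc)
    qed
  qed
qed

section \<open>The limit measure and its Verblunsky coefficients\<close>

lemma nn_integral_poly_sq_mult:
  assumes \<mu>: "circle_prob_measure \<mu>"
    and w: "w \<in> borel_measurable \<mu>" "\<And>z. 0 \<le> w z" "integrable \<mu> w"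
  shows "integrable \<mu> (\<lambda>z. w z * (cmod (poly P z))\<^sup>2)"
    and "(\<integral>\<^sup>+z. ennreal (w z * (cmod (poly P z))\<^sup>2) \<partial>\<mu>) = ennreal (LINT z|\<mu>. w z * (cmod (poly P z))\<^sup>2)"
proof -
  obtain B where B: "0 \<le> B" "\<And>z. cmod z = 1 \<Longrightarrow> (cmod (poly P z))\<^sup>2 \<le> B"
    using cmod_poly_sq_bounded by blast
  note [measurable] = w(1) borel_measurable_poly_sq[OF \<mu>]
  show int: "integrable \<mu> (\<lambda>z. w z * (cmod (poly P z))\<^sup>2)"
  proof (rule Bochner_Integration.integrable_bound)
    show "integrable \<mu> (\<lambda>z. B * w z)" using w by simp
    show "AE z in \<mu>. norm (w z * (cmod (poly P z))\<^sup>2) \<le> norm (B * w z)"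
    proof (rule AE_I2)
      fix z assume "z \<in> space \<mu>"
      then have "cmod z = 1" by (simp add: circle_prob_measureD(2)[OF \<mu>])
      from mult_left_mono[OF B(2)[OF this] w(2)[of z]]
      show "norm (w z * (cmod (poly P z))\<^sup>2) \<le> norm (B * w z)"
        using B(1) w(2)[of z] by (simp add: abs_mult mult.commute)
    qed
  qed measurable
  show "(\<integral>\<^sup>+z. ennreal (w z * (cmod (poly P z))\<^sup>2) \<partial>\<mu>) = ennreal (LINT z|\<mu>. w z * (cmod (poly P z))\<^sup>2)"
    using int w by (intro nn_integral_eq_integral) auto
qed

text \<open>Since \<open>g\<close> vanishes nowhere, a set on which it vanishes almost everywhere
  must already be null.\<close>

lemma equivalent_measures_density:
  assumes [measurable]: "g \<in> borel_measurable M" and pos: "\<And>z. 0 < g z"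
  shows "equivalent_measures M (density M g)"
proof -
  have "A \<in> null_sets M" if "A \<in> null_sets (density M g)" for A
  proof -
    from that have "A \<in> sets M" "AE z in M. z \<in> A \<longrightarrow> g z = 0"
      by (auto simp: null_sets_density_iff)
    with pos show ?thesis by (subst AE_iff_null_sets) (auto simp: less_le)
  qed
  then show ?thesis
    unfolding equivalent_measures_def absolutely_continuous_def[of "density M g"]
    by (auto intro: absolutely_continuousI_density)
qed

theorem theorem2p5:
  fixes \<mu> :: "complex measure"
  assumes "circle_prob_measure \<mu>"
    and "supp_measure \<mu> = sphere 0 1"
  shows "\<exists>\<nu>. circle_prob_measure \<nu> \<and> equivalent_measures \<mu> \<nu> \<and>
           (\<forall>p::real. p > 2 \<longrightarrow> summable (\<lambda>n. cmod (verblunsky \<nu> n) powr p))"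
proof -
  note \<mu> = assms(1)
  interpret prob_space \<mu> by (rule circle_prob_measureD[OF \<mu>])
  define A where "A = {w :: complex \<Rightarrow> real. w \<in> borel_measurable \<mu> \<and> (\<forall>z. 0 \<le> w z) \<and> integrable \<mu> w \<and> (LINT z|\<mu>. w z) = 1}"
  define W where "W w P = (LINT z|\<mu>. w z * (cmod (poly P z))\<^sup>2)" for w P
  \<comment> \<open>Half of \<open>\<mu>\<close> is kept throughout, which later bounds the density
    below; the other half of the mass is the initial Lebesgue part.\<close>
  define F0 where "F0 P = L2_sq \<mu> P / 2" for P
  obtain N :: "nat \<Rightarrow> nat" and w :: "nat \<Rightarrow> complex \<Rightarrow> real" where N: "strict_mono N" and wA: "\<And>k. w k \<in> A"
    and approx: "\<And>Q k. (\<And>P. (\<lambda>j. piece_mass j * W (w j) P) sums (Q P - F0 P)) \<Longrightarrow>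
       \<exists>I>0. (\<exists>P. lead_coeff P = 1 \<and> degree P \<le> N k \<and> Q P \<le> (1 + tail_mass k)\<^sup>2 * I) \<and>
         (\<forall>P. lead_coeff P = 1 \<longrightarrow> degree P \<le> N (Suc k) \<longrightarrow>
            (1 - tail_mass (Suc k)) * (tail_mass (Suc k) / tail_mass k) * I \<le> Q P)"
  proof (rule staged_approximation[of F0 A W])
    show "0 \<le> F0 P" for P by (simp add: F0_def L2_sq_nonneg)
    show "0 \<le> W w P" if "w \<in> A" for w P
      using that by (simp add: A_def W_def)
    show "\<exists>w\<in>A. approx_coeff_sqnorm (W w) N \<eta>" if "0 < \<eta>" for N \<eta>
      using exists_weight[OF assms that, of N] unfolding A_def W_def approx_coeff_sqnorm_def by blast
  qed blast
  have w: "w k \<in> borel_measurable \<mu>" "0 \<le> w k z" "integrable \<mu> (w k)" "(LINT z|\<mu>. w k z) = 1" for k z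
    using wA[of k] by (auto simp: A_def)
  note [measurable] = w(1) borel_measurable_poly_sq[OF \<mu>]
  \<comment> \<open>The series is taken in \<open>ennreal\<close>, so it is defined at every point
    even where it diverges; the constant makes \<open>g\<close> positive everywhere.\<close>
  define g where "g z = ennreal (1/2) + (\<Sum>k. ennreal (piece_mass k * w k z))" for z
  have g[measurable]: "g \<in> borel_measurable \<mu>" unfolding g_def by measurable
  define \<nu> where "\<nu> = density \<mu> g"
  \<comment> \<open>Each weight has integral 1, so \<open>W (w j) P\<close> is bounded by the
    maximum of the squared modulus of \<open>P\<close> uniformly in \<open>j\<close>, and the piece
    masses are summable.\<close>
  have W_sums: "(\<lambda>j. piece_mass j * W (w j) P) sums (\<Sum>j. piece_mass j * W (w j) P)" for P
  proof -
    obtain B where B: "0 \<le> B" "\<And>z. cmod z = 1 \<Longrightarrow> (cmod (poly P z))\<^sup>2 \<le> B"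
      using cmod_poly_sq_bounded by blast
    have W: "0 \<le> W (w j) P" "W (w j) P \<le> B" for j
    proof -
      show "0 \<le> W (w j) P" using w(2) by (simp add: W_def)
      have "W (w j) P \<le> (LINT z|\<mu>. w j z * B)"
        unfolding W_def
      proof (rule integral_mono[OF nn_integral_poly_sq_mult(1)[OF \<mu> w(1-3)]])
        show "integrable \<mu> (\<lambda>z. w j z * B)" using w(3) by simp
        fix z assume "z \<in> space \<mu>"
        then show "w j z * (cmod (poly P z))\<^sup>2 \<le> w j z * B"
          using w(2) by (intro mult_left_mono B(2)) (simp_all add: circle_prob_measureD(2)[OF \<mu>])
      qed
      also have "\<dots> = B" using w(4) by simp
      finally show "W (w j) P \<le> B" .
    qed
    have "summable (\<lambda>j. piece_mass j * W (w j) P)"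
    proof (rule summable_comparison_test')
      show "summable (\<lambda>j. piece_mass j * B)"
        using piece_mass_sums[of 0] by (intro summable_mult2) (simp add: sums_iff)
      show "norm (piece_mass j * W (w j) P) \<le> piece_mass j * B" for j
        using W[of j] piece_mass_nonneg[of j] by (simp add: abs_mult mult_left_mono)
    qed
    then show ?thesis by (rule summable_sums)
  qed
  define S where "S P = F0 P + (\<Sum>j. piece_mass j * W (w j) P)" for P
  have S_nonneg: "0 \<le> (\<Sum>j. piece_mass j * W (w j) P)" for P
    using W_sums[of P] w(2) by (intro suminf_nonneg) (auto simp: sums_iff W_def piece_mass_nonneg)
  have nn_\<nu>: "(\<integral>\<^sup>+z. ennreal ((cmod (poly P z))\<^sup>2) \<partial>\<nu>) = ennreal (S P)" for P
  proof -
    have "(\<integral>\<^sup>+z. ennreal ((cmod (poly P z))\<^sup>2) \<partial>\<nu>) = (\<integral>\<^sup>+z. g z * ennreal ((cmod (poly P z))\<^sup>2) \<partial>\<mu>)"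
      unfolding \<nu>_def by (rule nn_integral_density) measurable
    also have "\<dots> = (\<integral>\<^sup>+z. ennreal ((1/2) * (cmod (poly P z))\<^sup>2) +
        (\<Sum>k. ennreal (piece_mass k) * ennreal (w k z * (cmod (poly P z))\<^sup>2)) \<partial>\<mu>)"
      unfolding g_def distrib_right ennreal_suminf_multc[symmetric]
      by (simp add: ennreal_mult'[symmetric] ennreal_mult[symmetric] piece_mass_nonneg w(2) mult.assoc
          del: ennreal_half)
    also have "\<dots> = (\<integral>\<^sup>+z. ennreal ((1/2) * (cmod (poly P z))\<^sup>2) \<partial>\<mu>) +
        (\<Sum>k. ennreal (piece_mass k) * (\<integral>\<^sup>+z. ennreal (w k z * (cmod (poly P z))\<^sup>2) \<partial>\<mu>))"
      by (simp add: nn_integral_add nn_integral_suminf nn_integral_cmult)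
    also have "(\<integral>\<^sup>+z. ennreal ((1/2) * (cmod (poly P z))\<^sup>2) \<partial>\<mu>) = ennreal (F0 P)"
      by (subst nn_integral_poly_sq_mult(2)[OF \<mu>]) (auto simp: F0_def L2_sq_def)
    also have "(\<Sum>k. ennreal (piece_mass k) * (\<integral>\<^sup>+z. ennreal (w k z * (cmod (poly P z))\<^sup>2) \<partial>\<mu>))
        = (\<Sum>k. ennreal (piece_mass k * W (w k) P))"
      by (simp add: nn_integral_poly_sq_mult(2)[OF \<mu> w(1-3)] W_def ennreal_mult' piece_mass_nonneg)
    also have "\<dots> = ennreal (\<Sum>k. piece_mass k * W (w k) P)"
      using W_sums[of P] w(2) by (intro suminf_ennreal2) (auto simp: sums_iff W_def piece_mass_nonneg)
    finally show ?thesis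
      using S_nonneg[of P] by (simp add: S_def F0_def L2_sq_nonneg ennreal_plus)
  qed
  have sets_\<nu>: "sets \<nu> = sets \<mu>" by (simp add: \<nu>_def)
  \<comment> \<open>The retained part of \<open>\<mu>\<close> gives one half and the pieces give
    \<open>tail_mass 0\<close>, the other half.\<close>
  have "S 1 = 1"
    using piece_mass_sums[of 0] w(4) by (simp add: S_def F0_def L2_sq_def W_def sums_iff tail_mass_def prob_space)
  then have "emeasure \<nu> (space \<nu>) = 1"
    using nn_\<nu>[of 1] by simp
  then have \<nu>: "circle_prob_measure \<nu>"
    using circle_prob_measureD(3)[OF \<mu>] by (simp add: circle_prob_measure_def sets_\<nu> prob_spaceI)
  have L2_\<nu>: "L2_sq \<nu> P = S P" for P
  proof -
    have "L2_sq \<nu> P = enn2real (ennreal (S P))"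
      unfolding L2_sq_def nn_\<nu>[symmetric]
      by (intro integral_eq_nn_integral borel_measurable_poly_sq[OF \<nu>]) auto
    moreover have "0 \<le> S P" using S_nonneg[of P] by (simp add: S_def F0_def L2_sq_nonneg)
    ultimately show ?thesis by simp
  qed
  have equiv: "equivalent_measures \<mu> \<nu>"
    unfolding \<nu>_def by (rule equivalent_measures_density) (auto simp: g_def zero_less_iff_neq_zero)
  \<comment> \<open>Equivalence transfers full support to \<open>\<nu>\<close>, which makes
    \<open>\<nu>\<close> nontrivial, so that \<open>opuc\<close> really selects its orthogonal
    polynomials.\<close>
  have "supp_measure \<mu> = supp_measure \<nu>"
    by (rule supp_measure_equivalent[OF sets_\<nu>[symmetric] equiv])
      (auto simp: circle_prob_measureD[OF \<mu>] sets_restrict_space)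
  then have "\<exists>!p. is_monic_orthogonal \<nu> n p" for n
    using assms(2) by (intro ex1_monic_orthogonal[OF \<nu>] full_support_not_finitely_supported[OF \<nu>]) auto
  then have \<Phi>: "is_monic_orthogonal \<nu> n (opuc \<nu> n)" for n
    unfolding opuc_def by (rule theI')
  define \<Lambda> where "\<Lambda> n = L2_sq \<nu> (opuc \<nu> n)" for n
  have verb: "(cmod (verblunsky \<nu> n))\<^sup>2 * \<Lambda> n \<le> \<Lambda> n - \<Lambda> (Suc n)" for n
    unfolding \<Lambda>_def by (rule cmod_verblunsky_le[OF \<nu> \<Phi>])
  have "\<Lambda> (Suc n) \<le> \<Lambda> n" for n
  proof -
    have "0 \<le> (cmod (verblunsky \<nu> n))\<^sup>2 * \<Lambda> n" by (simp add: \<Lambda>_def L2_sq_nonneg)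
    with verb[of n] show ?thesis by simp
  qed
  then have anti: "\<Lambda> n \<le> \<Lambda> m" if "m \<le> n" for m n
    using that by (rule lift_Suc_antimono_le)
  \<comment> \<open>A power of \<open>z\<close> raises the degree to exactly \<open>n\<close>
    without changing the modulus on the circle.\<close>
  have \<Lambda>_le: "\<Lambda> n \<le> L2_sq \<nu> P" if "lead_coeff P = 1" "degree P \<le> n" for n P
  proof -
    have "\<Lambda> n \<le> L2_sq \<nu> (monom 1 (n - degree P) * P)"
      unfolding \<Lambda>_def
    proof (rule monic_orthogonal_minimal[OF \<nu> \<Phi>])
      show "degree (monom 1 (n - degree P) * P) \<le> n"
        using that(2) degree_mult_le[of "monom 1 (n - degree P)" P] by (simp add: degree_monom_eq)
      show "coeff (monom 1 (n - degree P) * P) n = 1"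
        using that by (simp add: coeff_monom_mult)
    qed
    also have "\<dots> = L2_sq \<nu> P"
      by (rule L2_sq_cong[OF \<nu>]) (simp add: poly_monom norm_mult norm_power)
    finally show ?thesis .
  qed
  have block: "(\<Sum>n = N k..<N (Suc k). (cmod (verblunsky \<nu> n))\<^sup>2) \<le> 15 / (real k + 2)" for k
  proof -
    define t where "t = tail_mass k"
    define L where "L = \<Lambda> (N (Suc k))"
    have t: "0 < t" "t \<le> 1" by (simp_all add: t_def tail_mass_def)
    have S_sums: "(\<lambda>j. piece_mass j * W (w j) P) sums (S P - F0 P)" for P
      using W_sums by (simp add: S_def)
    obtain I P where I: "0 < I" and P: "lead_coeff P = 1" "degree P \<le> N k" "S P \<le> (1 + t)\<^sup>2 * I"
      and lower: "\<And>P. lead_coeff P = 1 \<Longrightarrow> degree P \<le> N (Suc k) \<Longrightarrow>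
            (1 - tail_mass (Suc k)) * (tail_mass (Suc k) / t) * I \<le> S P"
      using approx[of S k, OF S_sums] unfolding t_def by blast
    \<comment> \<open>Both factors equal \<open>(k + 2) / (k + 3)\<close>, which is
      \<open>1 / (1 + t)\<close>.\<close>
    have "(1 - tail_mass (Suc k)) * (tail_mass (Suc k) / t) = 1 / (1 + t)\<^sup>2"
      by (simp add: t_def tail_mass_def divide_simps power2_eq_square)
    moreover have "(1 - tail_mass (Suc k)) * (tail_mass (Suc k) / t) * I \<le> L"
      using lower[of "opuc \<nu> (N (Suc k))"] \<Phi>[of "N (Suc k)"]
      by (auto simp: L_def \<Lambda>_def L2_\<nu> is_monic_orthogonal_def)
    ultimately have "1 / (1 + t)\<^sup>2 * I \<le> L" by (simp only:)
    then have L: "I \<le> (1 + t)\<^sup>2 * L"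
      using t by (simp add: divide_le_eq mult.commute)
    then have "0 < (1 + t)\<^sup>2 * L" using I by linarith
    then have L_pos: "0 < L" using t by (simp add: zero_less_mult_iff)
    \<comment> \<open>Comparing both ends of the block with \<open>I\<close> costs
      \<open>(1 + t) ^ 4\<close> in total; for \<open>t \<le> 1\<close> the binomial coefficients 4,
      6, 4, 1 add up to the constant 15.\<close>
    have "\<Lambda> (N k) \<le> (1 + t)\<^sup>2 * I" using \<Lambda>_le[OF P(1,2)] P(3) by (simp add: L2_\<nu>)
    also have "\<dots> \<le> (1 + t)\<^sup>2 * ((1 + t)\<^sup>2 * L)" using L by (intro mult_left_mono) auto
    also have "\<dots> = (1 + t) ^ 4 * L" by (simp add: power2_eq_square power4_eq_xxxx)
    also have "\<dots> \<le> (1 + 15 * t) * L"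
    proof (rule mult_right_mono)
      have "t ^ 2 \<le> t" "t ^ 3 \<le> t" "t ^ 4 \<le> t"
        using t power_decreasing[of 1 _ t] by simp_all
      moreover have "(1 + t) ^ 4 = 1 + 4 * t + 6 * t ^ 2 + 4 * t ^ 3 + t ^ 4" by algebra
      ultimately show "(1 + t) ^ 4 \<le> 1 + 15 * t" by linarith
    qed (use L_pos in simp)
    finally have ratio: "\<Lambda> (N k) - L \<le> 15 * t * L" by (simp add: algebra_simps)
    \<comment> \<open>\<open>L\<close> is a lower bound for \<open>\<Lambda>\<close> on the block,
      so it can replace each \<open>\<Lambda> n\<close> on the left while the right side
      telescopes.\<close>
    have "(\<Sum>n = N k..<N (Suc k). (cmod (verblunsky \<nu> n))\<^sup>2) * L \<le> (\<Sum>n = N k..<N (Suc k). \<Lambda> n - \<Lambda> (Suc n))"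
      unfolding sum_distrib_right
    proof (rule sum_mono)
      fix n assume "n \<in> {N k..<N (Suc k)}"
      then have "L \<le> \<Lambda> n" unfolding L_def by (intro anti) simp
      then have "(cmod (verblunsky \<nu> n))\<^sup>2 * L \<le> (cmod (verblunsky \<nu> n))\<^sup>2 * \<Lambda> n" by (rule mult_left_mono) simp
      with verb[of n] show "(cmod (verblunsky \<nu> n))\<^sup>2 * L \<le> \<Lambda> n - \<Lambda> (Suc n)" by linarith
    qed
    also have "\<dots> = \<Lambda> (N k) - L"
      using sum_Suc_diff'[of "N k" "N (Suc k)" "\<lambda>n. - \<Lambda> n"] strict_monoD[OF N, of k "Suc k"] by (simp add: L_def)
    also have "\<dots> \<le> 15 * t * L" by (rule ratio)
    finally have "(\<Sum>n = N k..<N (Suc k). (cmod (verblunsky \<nu> n))\<^sup>2) \<le> 15 * t"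
      using L_pos by (rule mult_right_le_imp_le)
    then show ?thesis by (simp add: t_def tail_mass_def)
  qed
  have "summable (\<lambda>n. cmod (verblunsky \<nu> n) powr p)" if "p > 2" for p
    by (rule summable_powr_of_block_squares[OF _ N block that]) simp
  with \<nu> equiv show ?thesis by blast
qed

end
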